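(* Assume that $I$ is centered at $0$. For any function $f\colon I^n\to\mathbb{R}$, the following assertions are equivalent. (i) $f$ is horizontally median-additive. (ii) $f$ is positively horizontally min-additive (or positively comonotonically additive), negatively horizontally max-additive (or negatively comonotonically additive), and satisfies $f(\mathbf{x})=f(\mathbf{x}^+)+f(-\mathbf{x}^-)$ for every $\mathbf{x}\in I^n$. (iii) There exist $g\colon I^n\to\mathbb{R}$ and $h\colon I^n\to\mathbb{R}$, with $\delta_g^A|_{I_+}$ and $\delta_h^A|_{I_-}$ additive for every $A\subseteq[n]$, such that, for every $\sigma\in S_n$ and every $\mathbf{x}\in I^n_\sigma$, $$f(\mathbf{x})=\delta_g^{A_\sigma^{\uparrow}(p+1)}(x_{\sigma(p+1)})+\sum_{i=p+2}^n\delta_g^{A_\sigma^{\uparrow}(i)}\big(x_{\sigma(i)}-x_{\sigma(i-1)}\big)+\delta_h^{A_\sigma^{\downarrow}(p)}(x_{\sigma(p)})+\sum_{i=1}^{p-1}\delta_h^{A_\sigma^{\downarrow}(i)}\big(x_{\sigma(i)}-x_{\sigma(i+1)}\big),$$ where $p\in\{0,\ldots,n\}$ is such that $x_{\sigma(p)}<0\leq x_{\sigma(p+1)}$. In this case, we can choose $g=h=f$.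
   Context: $n\geq 1$ is an integer, $[n]=\{1,\ldots,n\}$, $S_n$ is the set of permutations of $[n]$, and $I$ is a nontrivial (i.e., of positive measure) real interval, possibly unbounded, containing $0$; "centered at $0$" means $-x\in I$ for every $x\in I$. $I_+=I\cap[0,+\infty[$, $I_-=I\cap\,]-\infty,0]$. For $\sigma\in S_n$, $I^n_\sigma=\{\mathbf{x}\in I^n : x_{\sigma(1)}\leq\cdots\leq x_{\sigma(n)}\}$, $A_\sigma^{\uparrow}(i)=\{\sigma(i),\ldots,\sigma(n)\}$ with $A_\sigma^{\uparrow}(n+1)=\varnothing$, and $A_\sigma^{\downarrow}(i)=\{\sigma(1),\ldots,\sigma(i)\}$ with $A_\sigma^{\downarrow}(0)=\varnothing$. For $A\subseteq[n]$, $\mathbf{1}_A$ is the $n$-tuple whose $i$th component is $1$ if $i\in A$ and $0$ otherwise; for $g\colon I^n\to\mathbb{R}$, $\delta_g^A\colon I\to\mathbb{R}$ is defined by $\delta_g^A(x)=g(x\mathbf{1}_A)$, and $\delta_g=\delta_g^{[n]}$. A function $u\colon K\to\mathbb{R}$ on an interval $K$ is additive if $u(x+x')=u(x)+u(x')$ whenever $x,x',x+x'\in K$. Conventions for the integer $p$: $p$ is the number of strictly negative components of $\mathbf{x}$ (an inequality involving the nonexistent $x_{\sigma(0)}$ or $x_{\sigma(n+1)}$ is dropped); if $p=n$ the term $\delta_g^{A_\sigma^{\uparrow}(n+1)}(x_{\sigma(n+1)})$ is read as $0$, and if $p=0$ the term $\delta_h^{A_\sigma^{\downarrow}(0)}(x_{\sigma(0)})$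 is read as $0$; empty sums are $0$. For $\mathbf{x}\in\mathbb{R}^n$ and $c\in\mathbb{R}$, $\mathbf{x}\wedge c$ (resp. $\mathbf{x}\vee c$) is the $n$-tuple whose $i$th component is $\min(x_i,c)$ (resp. $\max(x_i,c)$); $\mathbf{x}^+=\mathbf{x}\vee 0$, $\mathbf{x}^-=(-\mathbf{x})^+$, $[\mathbf{x}]_c=\mathbf{x}-(\mathbf{x}\wedge c)$, $[\mathbf{x}]^c=\mathbf{x}-(\mathbf{x}\vee c)$. For $c\geq 0$, $\mathrm{med}(-c,\mathbf{x},c)$ is the $n$-tuple whose $i$th component is the middle value of $-c,x_i,c$. Two $n$-tuples in $I^n$ are comonotonic if both lie in $I^n_\sigma$ for some $\sigma\in S_n$. A function $f\colon I^n\to\mathbb{R}$ is: - horizontally median-additive if $f(\mathbf{x})=f(\mathrm{med}(-c,\mathbf{x},c))+f([\mathbf{x}]_c)+f([\mathbf{x}]^{-c})$ for every $\mathbf{x}\in I^n$ and every $c\in I_+$; - positively horizontally min-additive if $f(\mathbf{x})=f(\mathbf{x}\wedge c)+f([\mathbf{x}]_c)$ for every $\mathbf{x}\in I_+^n$ and every $c\in I_+$; - negatively horizontally max-additive if $f(\mathbf{x})=f(\mathbf{x}\vee c)+f([\mathbf{x}]^c)$ for every $\mathbf{x}\in I_-^n$ and every $c\in I_-$; - positively (resp. negatively) comonotonically additive if $f(\mathbf{x}+\mathbf{x}')=f(\mathbf{x})+f(\mathbf{x}')$ for all comonotonic $\mathbf{x},\mathbf{x}'\in I_+^n$ (resp.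 $I_-^n$) such that $\mathbf{x}+\mathbf{x}'\in I_+^n$ (resp. $I_-^n$). In (ii), each "or" means that either of the two named properties may be used; each choice gives an assertion equivalent to (i) and (iii). *)

theory Defs
  imports "HOL-Analysis.Analysis" "HOL-Combinatorics.Permutations"
begin

text \<open>
  An \<open>n\<close>-tuple is an extensional function on \<open>{1..n}\<close>; all tuple operations below
  therefore restrict their results to \<open>{1..n}\<close>. A function on the \<open>n\<close>-th power of \<open>I\<close> is a HOL
  function on \<open>nat \<Rightarrow> real\<close> of which only the values on \<open>cube n I\<close> matter.
\<close>

definition cube :: "nat \<Rightarrow> real set \<Rightarrow> (nat \<Rightarrow> real) set" where
  "cube n I = {1..n} \<rightarrow>\<^sub>E I"

definition nonneg_part :: "real set \<Rightarrow> real set" where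
  "nonneg_part I = I \<inter> {0..}"

definition nonpos_part :: "real set \<Rightarrow> real set" where
  "nonpos_part I = I \<inter> {..0}"

definition tplus :: "nat \<Rightarrow> (nat \<Rightarrow> real) \<Rightarrow> (nat \<Rightarrow> real) \<Rightarrow> nat \<Rightarrow> real" where
  "tplus n x y = (\<lambda>i\<in>{1..n}. x i + y i)"

definition tminus :: "nat \<Rightarrow> (nat \<Rightarrow> real) \<Rightarrow> (nat \<Rightarrow> real) \<Rightarrow> nat \<Rightarrow> real" where
  "tminus n x y = (\<lambda>i\<in>{1..n}. x i - y i)"

definition tneg :: "nat \<Rightarrow> (nat \<Rightarrow> real) \<Rightarrow> nat \<Rightarrow> real" where
  "tneg n x = (\<lambda>i\<in>{1..n}. - x i)"

definition tmin :: "nat \<Rightarrow> (nat \<Rightarrow> real) \<Rightarrow> real \<Rightarrow> nat \<Rightarrow> real" where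
  "tmin n x c = (\<lambda>i\<in>{1..n}. min (x i) c)"

definition tmax :: "nat \<Rightarrow> (nat \<Rightarrow> real) \<Rightarrow> real \<Rightarrow> nat \<Rightarrow> real" where
  "tmax n x c = (\<lambda>i\<in>{1..n}. max (x i) c)"

definition tpos :: "nat \<Rightarrow> (nat \<Rightarrow> real) \<Rightarrow> nat \<Rightarrow> real" where
  "tpos n x = tmax n x 0"

definition tnegpart :: "nat \<Rightarrow> (nat \<Rightarrow> real) \<Rightarrow> nat \<Rightarrow> real" where
  "tnegpart n x = tpos n (tneg n x)"

text \<open>\<open>cut_above n x c\<close> is $[\mathbf{x}]_c$ and \<open>cut_below n x c\<close> is $[\mathbf{x}]^c$.\<close>

definition cut_above :: "nat \<Rightarrow> (nat \<Rightarrow> real) \<Rightarrow> real \<Rightarrow> nat \<Rightarrow> real" where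
  "cut_above n x c = tminus n x (tmin n x c)"

definition cut_below :: "nat \<Rightarrow> (nat \<Rightarrow> real) \<Rightarrow> real \<Rightarrow> nat \<Rightarrow> real" where
  "cut_below n x c = tminus n x (tmax n x c)"

definition middle :: "real \<Rightarrow> real \<Rightarrow> real \<Rightarrow> real" where
  "middle a b c = sort [a, b, c] ! 1"

lemma middle_symmetric: "0 \<le> c \<Longrightarrow> middle (- c) t c = max (- c) (min t c)"
  by (auto simp: middle_def)

definition tmed :: "nat \<Rightarrow> real \<Rightarrow> (nat \<Rightarrow> real) \<Rightarrow> real \<Rightarrow> nat \<Rightarrow> real" where
  "tmed n a x b = (\<lambda>i\<in>{1..n}. middle a (x i) b)"

definition region :: "nat \<Rightarrow> real set \<Rightarrow> (nat \<Rightarrow> nat) \<Rightarrow> (nat \<Rightarrow> real) set" where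
  "region n I \<sigma> = {x \<in> cube n I. \<forall>i\<in>{1..<n}. x (\<sigma> i) \<le> x (\<sigma> (Suc i))}"

definition comonotonic :: "nat \<Rightarrow> real set \<Rightarrow> (nat \<Rightarrow> real) \<Rightarrow> (nat \<Rightarrow> real) \<Rightarrow> bool" where
  "comonotonic n I x y \<longleftrightarrow> (\<exists>\<sigma>. \<sigma> permutes {1..n} \<and> x \<in> region n I \<sigma> \<and> y \<in> region n I \<sigma>)"

definition horizontally_median_additive ::
    "nat \<Rightarrow> real set \<Rightarrow> ((nat \<Rightarrow> real) \<Rightarrow> real) \<Rightarrow> bool" where
  "horizontally_median_additive n I f \<longleftrightarrow>
     (\<forall>x\<in>cube n I. \<forall>c\<in>nonneg_part I.
        f x = f (tmed n (- c) x c) + f (cut_above n x c) + f (cut_below n x (- c)))"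

definition pos_horizontally_min_additive ::
    "nat \<Rightarrow> real set \<Rightarrow> ((nat \<Rightarrow> real) \<Rightarrow> real) \<Rightarrow> bool" where
  "pos_horizontally_min_additive n I f \<longleftrightarrow>
     (\<forall>x\<in>cube n (nonneg_part I). \<forall>c\<in>nonneg_part I.
        f x = f (tmin n x c) + f (cut_above n x c))"

definition neg_horizontally_max_additive ::
    "nat \<Rightarrow> real set \<Rightarrow> ((nat \<Rightarrow> real) \<Rightarrow> real) \<Rightarrow> bool" where
  "neg_horizontally_max_additive n I f \<longleftrightarrow>
     (\<forall>x\<in>cube n (nonpos_part I). \<forall>c\<in>nonpos_part I.
        f x = f (tmax n x c) + f (cut_below n x c))"

definition comonotonically_additive_on ::
    "nat \<Rightarrow> real set \<Rightarrow> real set \<Rightarrow> ((nat \<Rightarrow> real) \<Rightarrow> real) \<Rightarrow> bool" where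
  "comonotonically_additive_on n I J f \<longleftrightarrow>
     (\<forall>x\<in>cube n J. \<forall>x'\<in>cube n J. comonotonic n I x x' \<longrightarrow> tplus n x x' \<in> cube n J \<longrightarrow>
        f (tplus n x x') = f x + f x')"

definition pos_comonotonically_additive ::
    "nat \<Rightarrow> real set \<Rightarrow> ((nat \<Rightarrow> real) \<Rightarrow> real) \<Rightarrow> bool" where
  "pos_comonotonically_additive n I f \<longleftrightarrow> comonotonically_additive_on n I (nonneg_part I) f"

definition neg_comonotonically_additive ::
    "nat \<Rightarrow> real set \<Rightarrow> ((nat \<Rightarrow> real) \<Rightarrow> real) \<Rightarrow> bool" where
  "neg_comonotonically_additive n I f \<longleftrightarrow> comonotonically_additive_on n I (nonpos_part I) f"

definition sign_split ::
    "nat \<Rightarrow> real set \<Rightarrow> ((nat \<Rightarrow> real) \<Rightarrow> real) \<Rightarrow> bool" where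
  "sign_split n I f \<longleftrightarrow> (\<forall>x\<in>cube n I. f x = f (tpos n x) + f (tneg n (tnegpart n x)))"

definition upset :: "nat \<Rightarrow> (nat \<Rightarrow> nat) \<Rightarrow> nat \<Rightarrow> nat set" where
  "upset n \<sigma> i = \<sigma> ` {i..n}"

definition downset :: "(nat \<Rightarrow> nat) \<Rightarrow> nat \<Rightarrow> nat set" where
  "downset \<sigma> i = \<sigma> ` {1..i}"

definition delta :: "nat \<Rightarrow> ((nat \<Rightarrow> real) \<Rightarrow> real) \<Rightarrow> nat set \<Rightarrow> real \<Rightarrow> real" where
  "delta n g A t = g (\<lambda>i\<in>{1..n}. t * indicator A i)"

definition additive_on :: "real set \<Rightarrow> (real \<Rightarrow> real) \<Rightarrow> bool" where
  "additive_on K u \<longleftrightarrow> (\<forall>s\<in>K. \<forall>t\<in>K. s + t \<in> K \<longrightarrow> u (s + t) = u s + u t)"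

definition neg_count :: "nat \<Rightarrow> (nat \<Rightarrow> real) \<Rightarrow> nat" where
  "neg_count n x = card {i\<in>{1..n}. x i < 0}"

text \<open>
  On \<open>region n I \<sigma>\<close>, the number of negative components is the only \<open>p \<le> n\<close> that separates
  the negative entries of the sorted tuple from the nonnegative ones.
\<close>

lemma neg_count_iff:
  assumes \<sigma>: "\<sigma> permutes {1..n}" and x: "x \<in> region n I \<sigma>"
  shows "p = neg_count n x \<longleftrightarrow>
    p \<le> n \<and> (1 \<le> p \<longrightarrow> x (\<sigma> p) < 0) \<and> (p < n \<longrightarrow> 0 \<le> x (\<sigma> (p + 1)))"
proof -
  have next_le: "x (\<sigma> i) \<le> x (\<sigma> (Suc i))" if "1 \<le> i" "i < n" for i
    using x that by (auto simp: region_def)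
  have mono: "x (\<sigma> i) \<le> x (\<sigma> j)" if "i \<le> j" "1 \<le> i" "j \<le> n" for i j
    using that(1,3)
  proof (induction j rule: dec_induct)
    case (step j)
    then have "x (\<sigma> i) \<le> x (\<sigma> j)" by linarith
    also have "\<dots> \<le> x (\<sigma> (Suc j))" using next_le[of j] step.hyps step.prems \<open>1 \<le> i\<close> by linarith
    finally show ?case .
  qed simp
  have inj: "inj_on \<sigma> S" for S
    using permutes_inj[OF \<sigma>] by (auto intro: inj_on_subset)
  have card: "neg_count n x = card {i\<in>{1..n}. x (\<sigma> i) < 0}"
  proof -
    have "{i\<in>{1..n}. x i < 0} = \<sigma> ` {i\<in>{1..n}. x (\<sigma> i) < 0}"
    proof -
      have "{i\<in>{1..n}. x i < 0} = {i \<in> \<sigma> ` {1..n}. x i < 0}"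
        using permutes_image[OF \<sigma>] by simp
      also have "\<dots> = \<sigma> ` {i\<in>{1..n}. x (\<sigma> i) < 0}"
        by (rule Compr_image_eq)
      finally show ?thesis .
    qed
    then show ?thesis unfolding neg_count_def using card_image[OF inj] by metis
  qed
  have suff: "p = neg_count n x"
    if p: "p \<le> n" "1 \<le> p \<longrightarrow> x (\<sigma> p) < 0" "p < n \<longrightarrow> 0 \<le> x (\<sigma> (p + 1))" for p
  proof -
    have "{i\<in>{1..n}. x (\<sigma> i) < 0} = {1..p}"
    proof (rule set_eqI)
      fix i
      show "i \<in> {i\<in>{1..n}. x (\<sigma> i) < 0} \<longleftrightarrow> i \<in> {1..p}"
      proof (cases "i \<le> p")
        case True
        then show ?thesis using mono[of i p] p by auto
      next
        case False
        then show ?thesis using mono[of "p + 1" i] p by auto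
      qed
    qed
    then show ?thesis by (simp add: card)
  qed
  define q where "q = Max (insert 0 {i\<in>{1..n}. x (\<sigma> i) < 0})"
  have "q \<in> insert 0 {i\<in>{1..n}. x (\<sigma> i) < 0}"
    unfolding q_def by (rule Max_in) auto
  moreover have "0 \<le> x (\<sigma> (q + 1))" if "q < n"
  proof (rule ccontr)
    assume "\<not> 0 \<le> x (\<sigma> (q + 1))"
    then have "q + 1 \<in> insert 0 {i\<in>{1..n}. x (\<sigma> i) < 0}"
      using that by simp
    then have "q + 1 \<le> Max (insert 0 {i\<in>{1..n}. x (\<sigma> i) < 0})"
      by (intro Max_ge) simp_all
    then have "q + 1 \<le> q"
      by (simp only: q_def)
    then show False by simp
  qed
  ultimately have q: "q \<le> n" "1 \<le> q \<longrightarrow> x (\<sigma> q) < 0" "q < n \<longrightarrow> 0 \<le> x (\<sigma> (q + 1))"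
    by auto
  show ?thesis using suff suff[OF q] q by blast
qed

text \<open>
  The boundary terms are the only ones that may refer to a nonexistent index: \<open>\<sigma> (n + 1)\<close>
  when \<open>p = n\<close> and \<open>\<sigma> 0\<close> when \<open>p = 0\<close>. The truncated \<open>p - 1\<close> gives an empty sum when \<open>p = 0\<close>.
\<close>

definition sorted_formula ::
    "nat \<Rightarrow> ((nat \<Rightarrow> real) \<Rightarrow> real) \<Rightarrow> ((nat \<Rightarrow> real) \<Rightarrow> real) \<Rightarrow> (nat \<Rightarrow> nat) \<Rightarrow> (nat \<Rightarrow> real) \<Rightarrow> real"
  where
  "sorted_formula n g h \<sigma> x =
     (let p = neg_count n x in
        (if p = n then 0 else delta n g (upset n \<sigma> (p + 1)) (x (\<sigma> (p + 1))))
      + (\<Sum>i = p + 2..n. delta n g (upset n \<sigma> i) (x (\<sigma> i) - x (\<sigma> (i - 1))))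
      + (if p = 0 then 0 else delta n h (downset \<sigma> p) (x (\<sigma> p)))
      + (\<Sum>i = 1..p - 1. delta n h (downset \<sigma> i) (x (\<sigma> i) - x (\<sigma> (i + 1)))))"

definition represented_by ::
    "nat \<Rightarrow> real set \<Rightarrow> ((nat \<Rightarrow> real) \<Rightarrow> real) \<Rightarrow> ((nat \<Rightarrow> real) \<Rightarrow> real) \<Rightarrow>
      ((nat \<Rightarrow> real) \<Rightarrow> real) \<Rightarrow> bool" where
  "represented_by n I f g h \<longleftrightarrow>
     (\<forall>A\<subseteq>{1..n}. additive_on (nonneg_part I) (delta n g A) \<and>
                 additive_on (nonpos_part I) (delta n h A)) \<and>
     (\<forall>\<sigma>. \<sigma> permutes {1..n} \<longrightarrow> (\<forall>x\<in>region n I \<sigma>. f x = sorted_formula n g h \<sigma> x))"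

end

theory Submission imports Defs begin

text \<open>
  Sort a nonnegative tuple as \<open>x (\<sigma> 1) \<le> \<dots> \<le> x (\<sigma> n)\<close> and cut it at the successive levels
  \<open>x (\<sigma> k)\<close>. The slice between two consecutive levels is a constant, the increment
  \<open>x (\<sigma> k) - x (\<sigma> (k - 1))\<close>, on the set of the coordinates that reach the upper level. Horizontal
  min-additivity says that \<open>f\<close> is additive over such cuts, so \<open>f x\<close> is the sum of the values
  of \<open>f\<close> on the slices (\<open>min_additive_imp_chain_represented\<close>); applied to the multiples of an
  indicator it also makes each \<open>delta n f A\<close> additive. Conversely, within one region the increments
  depend additively on the tuple, so a sum of additive functions of the increments is
  comonotonically additive (\<open>chain_represented_imp_comonotonically_additive\<close>). Finally a tuple and
  its two parts under a cut are sorted by the same permutation, which leads from comonotonic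
  additivity back to min-additivity. On the nonnegative cone the three notions therefore agree.

  The negative cone follows by the reflection \<open>x \<mapsto> - x\<close>, which carries max-additivity to
  min-additivity and reverses the sorting permutation; here \<open>I\<close> has to be centered at 0.

  The two cones are joined by the sign splitting. Cutting at \<open>c = 0\<close> shows that median-additivity
  contains it, and on a tuple of constant sign one of the three terms of the median cut vanishes;
  in the other direction the median cut is the min-cut of the positive part together with the
  max-cut of the negative part (\<open>median_additive_iff\<close>). Likewise the formula with the index \<open>p\<close> is
  the sum of the slice formulas of the positive part and of the reflected negative part, since
  the first \<open>p\<close> increments of the positive part are 0 (\<open>sorted_formula_eq_chain_sums\<close>). This makes it
  equivalent to two slice formulas, one on each cone, plus sign splitting (\<open>represented_by_iff\<close>).
\<close>

section \<open>Tuples\<close>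

definition zero_tuple :: "nat \<Rightarrow> nat \<Rightarrow> real" where
  "zero_tuple n = (\<lambda>i\<in>{1..n}. 0)"

lemmas tuple_defs = zero_tuple_def tplus_def tminus_def tneg_def tmin_def tmax_def tpos_def
  tnegpart_def cut_above_def cut_below_def

lemma cubeI: "x \<in> extensional {1..n} \<Longrightarrow> (\<And>i. i \<in> {1..n} \<Longrightarrow> x i \<in> I) \<Longrightarrow> x \<in> cube n I"
  by (auto simp: cube_def PiE_def)

lemma cube_component: "x \<in> cube n I \<Longrightarrow> i \<in> {1..n} \<Longrightarrow> x i \<in> I"
  by (auto simp: cube_def)

lemma cube_extensional: "x \<in> cube n I \<Longrightarrow> x \<in> extensional {1..n}"
  by (auto simp: cube_def PiE_def)

lemma tuple_extensional:
  "tneg n x \<in> extensional {1..n}" "tmin n x c \<in> extensional {1..n}"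
  "tmax n x c \<in> extensional {1..n}" "tpos n x \<in> extensional {1..n}"
  "tnegpart n x \<in> extensional {1..n}" "cut_above n x c \<in> extensional {1..n}"
  "cut_below n x c \<in> extensional {1..n}" "tplus n x y \<in> extensional {1..n}"
  "zero_tuple n \<in> extensional {1..n}"
  by (simp_all add: tuple_defs)

lemma tuple_eqI:
  assumes "x \<in> extensional {1..n}" "y \<in> extensional {1..n}" "\<And>i. i \<in> {1..n} \<Longrightarrow> x i = y i"
  shows "x = y"
  using assms by (rule extensionalityI)

lemma delta_zero: "delta n g A 0 = g (zero_tuple n)"
  by (simp add: delta_def zero_tuple_def)

lemma additive_delta_zero:
  assumes "additive_on (nonneg_part I) (delta n g A)" "0 \<in> I"
  shows "g (zero_tuple n) = 0"
  using assms by (auto simp: additive_on_def nonneg_part_def delta_zero dest!: bspec[where x=0])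

lemma zero_tuple_cube: "0 \<in> I \<Longrightarrow> zero_tuple n \<in> cube n I"
  by (auto simp: cube_def zero_tuple_def)

lemma cube_nonneg_partD:
  assumes "x \<in> cube n (nonneg_part I)"
  shows "x \<in> cube n I" "\<And>i. i \<in> {1..n} \<Longrightarrow> 0 \<le> x i"
  using assms by (auto simp: cube_def nonneg_part_def PiE_def Pi_def)

lemma cube_nonpos_partD:
  assumes "x \<in> cube n (nonpos_part I)"
  shows "x \<in> cube n I" "\<And>i. i \<in> {1..n} \<Longrightarrow> x i \<le> 0"
  using assms by (auto simp: cube_def nonpos_part_def PiE_def Pi_def)

lemma interval_below:
  fixes I :: "real set"
  assumes "is_interval I" "0 \<in> I" "a \<in> I" "0 \<le> t" "t \<le> a"
  shows "t \<in> nonneg_part I"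
  using mem_is_interval_1_I[OF assms(1,2,3)] assms(4,5) by (simp add: nonneg_part_def)

section \<open>Sorting permutations\<close>

lemma region_mono:
  assumes "x \<in> region n I \<sigma>" "1 \<le> i" "i \<le> j" "j \<le> n"
  shows "x (\<sigma> i) \<le> x (\<sigma> j)"
  using assms(3,4)
proof (induction j rule: dec_induct)
  case (step j)
  then have "x (\<sigma> i) \<le> x (\<sigma> j)" by simp
  also have "\<dots> \<le> x (\<sigma> (Suc j))"
    using assms(1,2) step by (auto simp: region_def)
  finally show ?case .
qed simp

lemma region_cube: "x \<in> region n I \<sigma> \<Longrightarrow> x \<in> cube n I"
  by (simp add: region_def)

lemma region_nonneg_part:
  "x \<in> region n (nonneg_part I) \<sigma> \<longleftrightarrow> x \<in> region n I \<sigma> \<and> x \<in> cube n (nonneg_part I)"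
  by (auto simp: region_def dest: cube_nonneg_partD)

text \<open>
  A monotone function applied to every component does not disturb the sorting. Truncations, excesses
  over a level and positive parts are all of this form.
\<close>

lemma region_image:
  assumes x: "x \<in> region n I \<sigma>" and \<sigma>: "\<sigma> permutes {1..n}"
    and \<phi>: "mono \<phi>" and y: "y \<in> cube n J" "\<And>i. i \<in> {1..n} \<Longrightarrow> y i = \<phi> (x i)"
  shows "y \<in> region n J \<sigma>"
proof -
  have "y (\<sigma> i) \<le> y (\<sigma> (Suc i))" if "i \<in> {1..<n}" for i
  proof -
    have "\<sigma> i \<in> {1..n}" "\<sigma> (Suc i) \<in> {1..n}"
      using that permutes_in_image[OF \<sigma>, of i] permutes_in_image[OF \<sigma>, of "Suc i"] by auto
    moreover have "x (\<sigma> i) \<le> x (\<sigma> (Suc i))"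
      using x that by (auto simp: region_def)
    ultimately show ?thesis using y(2) monoD[OF \<phi>] by simp
  qed
  with y(1) show ?thesis by (simp add: region_def)
qed

lemma sorting_permutation_exists:
  assumes "x \<in> cube n I"
  obtains \<sigma> where "\<sigma> permutes {1..n}" "x \<in> region n I \<sigma>"
proof -
  define xs where "xs = sort_key x [1..<Suc n]"
  define \<sigma> where "\<sigma> i = (if i \<in> {1..n} then xs ! (i - 1) else i)" for i
  have len: "length xs = n" and set: "set xs = {1..n}" and dist: "distinct xs"
    and srt: "sorted (map x xs)"
    by (auto simp: xs_def)
  have "bij_betw ((!) xs) {..<n} {1..n}"
    using bij_betw_nth[OF dist, of "{..<n}" "{1..n}"] len set by simp
  moreover have "bij_betw (\<lambda>i. i - 1) {1..n} {..<n}"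
    by (rule bij_betw_byWitness[where f' = Suc]) auto
  ultimately have "bij_betw ((!) xs \<circ> (\<lambda>i. i - 1)) {1..n} {1..n}"
    by (rule bij_betw_trans[rotated])
  then have "bij_betw \<sigma> {1..n} {1..n}"
    by (subst bij_betw_cong[where g = "(!) xs \<circ> (\<lambda>i. i - 1)"]) (auto simp: \<sigma>_def)
  then have "\<sigma> permutes {1..n}"
    by (rule bij_imp_permutes) (auto simp: \<sigma>_def)
  moreover have "x (\<sigma> i) \<le> x (\<sigma> (Suc i))" if "i \<in> {1..<n}" for i
    using sorted_nth_mono[OF srt, of "i - 1" i] that len by (auto simp: \<sigma>_def)
  ultimately show thesis using that assms by (auto simp: region_def)
qed

section \<open>Representation on the nonnegative cone\<close>

text \<open>
  The ground level \<open>k = 0\<close> is 0, so that the first slice is not an exceptional case.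
\<close>

definition level :: "(nat \<Rightarrow> nat) \<Rightarrow> (nat \<Rightarrow> real) \<Rightarrow> nat \<Rightarrow> real" where
  "level \<sigma> x k = (if k = 0 then 0 else x (\<sigma> k))"

text \<open>
  The total of the slices; for \<open>delta n g A t = t * \<mu> A\<close> it is the discrete Choquet integral.
\<close>

definition chain_sum ::
    "nat \<Rightarrow> ((nat \<Rightarrow> real) \<Rightarrow> real) \<Rightarrow> (nat \<Rightarrow> nat) \<Rightarrow> (nat \<Rightarrow> real) \<Rightarrow> real" where
  "chain_sum n g \<sigma> x = (\<Sum>i=1..n. delta n g (upset n \<sigma> i) (level \<sigma> x i - level \<sigma> x (i - 1)))"

definition chain_represented ::
    "nat \<Rightarrow> real set \<Rightarrow> ((nat \<Rightarrow> real) \<Rightarrow> real) \<Rightarrow> ((nat \<Rightarrow> real) \<Rightarrow> real) \<Rightarrow> bool" where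
  "chain_represented n I f g \<longleftrightarrow>
     (\<forall>A\<subseteq>{1..n}. additive_on (nonneg_part I) (delta n g A)) \<and>
     (\<forall>\<sigma>. \<sigma> permutes {1..n} \<longrightarrow>
        (\<forall>x\<in>region n (nonneg_part I) \<sigma>. f x = chain_sum n g \<sigma> x))"

lemma level_mono:
  assumes "x \<in> region n (nonneg_part I) \<sigma>" "\<sigma> permutes {1..n}" "i \<le> j" "j \<le> n"
  shows "level \<sigma> x i \<le> level \<sigma> x j"
proof (cases "i = 0")
  case True
  have "j \<noteq> 0 \<Longrightarrow> \<sigma> j \<in> {1..n}"
    using assms(4) permutes_in_image[OF assms(2), of j] by auto
  then show ?thesis
    using True cube_nonneg_partD(2)[OF region_cube[OF assms(1)]] by (auto simp: level_def)
next
  case False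
  then show ?thesis using region_mono[OF assms(1), of i j] assms(3,4) by (auto simp: level_def)
qed

text \<open>
  Since \<open>I\<close> is an interval around 0, the thickness of a slice is an admissible argument for the
  additivity of \<open>delta n g A\<close>.
\<close>

lemma level_increment_mem:
  assumes I: "is_interval I" "0 \<in> I"
    and x: "x \<in> region n (nonneg_part I) \<sigma>" and \<sigma>: "\<sigma> permutes {1..n}" and k: "i \<le> j" "j \<le> n"
  shows "level \<sigma> x j - level \<sigma> x i \<in> nonneg_part I"
proof (rule interval_below[OF I])
  have "j \<noteq> 0 \<Longrightarrow> \<sigma> j \<in> {1..n}"
    using k(2) permutes_in_image[OF \<sigma>, of j] by auto
  then show "level \<sigma> x j \<in> I"
    using I(2) cube_component[OF region_cube[OF x]] by (auto simp: level_def nonneg_part_def)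
  show "0 \<le> level \<sigma> x j - level \<sigma> x i" using level_mono[OF x \<sigma> k] by simp
  show "level \<sigma> x j - level \<sigma> x i \<le> level \<sigma> x j"
    using level_mono[OF x \<sigma>, of 0 i] k by (simp add: level_def)
qed

lemma min_additive_zero:
  assumes "pos_horizontally_min_additive n I f" "0 \<in> I"
  shows "f (zero_tuple n) = 0"
proof -
  have "0 \<in> nonneg_part I" using assms(2) by (simp add: nonneg_part_def)
  moreover from this have "zero_tuple n \<in> cube n (nonneg_part I)" by (rule zero_tuple_cube)
  ultimately have "f (zero_tuple n) = f (tmin n (zero_tuple n) 0) + f (cut_above n (zero_tuple n) 0)"
    using assms(1) unfolding pos_horizontally_min_additive_def by blast
  moreover have "tmin n (zero_tuple n) 0 = zero_tuple n" "cut_above n (zero_tuple n) 0 = zero_tuple n"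
    by (auto simp: tuple_defs)
  ultimately show ?thesis by simp
qed

text \<open>
  Cutting \<open>(s + t)\<close> times an indicator at the height \<open>s\<close> leaves \<open>s\<close> and \<open>t\<close> times that indicator.
\<close>

lemma min_additive_imp_delta_additive:
  assumes f: "pos_horizontally_min_additive n I f" and I: "0 \<in> I"
  shows "additive_on (nonneg_part I) (delta n f A)"
  unfolding additive_on_def
proof (intro ballI impI)
  fix s t assume s: "s \<in> nonneg_part I" and t: "t \<in> nonneg_part I" and st: "s + t \<in> nonneg_part I"
  define x where "x = (\<lambda>i\<in>{1..n}. (s + t) * indicator A i :: real)"
  have nonneg: "0 \<le> s" "0 \<le> t" using s t by (auto simp: nonneg_part_def)
  have "x \<in> cube n (nonneg_part I)"
    using I st by (auto simp: x_def cube_def indicator_def nonneg_part_def)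
  then have "f x = f (tmin n x s) + f (cut_above n x s)"
    using f s unfolding pos_horizontally_min_additive_def by blast
  moreover have "tmin n x s = (\<lambda>i\<in>{1..n}. s * indicator A i)"
    using nonneg by (auto simp: x_def tmin_def indicator_def)
  moreover have "cut_above n x s = (\<lambda>i\<in>{1..n}. t * indicator A i)"
    using nonneg by (auto simp: x_def tuple_defs indicator_def)
  ultimately show "delta n f A (s + t) = delta n f A s + delta n f A t"
    by (simp add: delta_def x_def)
qed

text \<open>
  The slices are removed one at a time from the bottom: what remains after \<open>k\<close> cuts is the excess
  of \<open>x\<close> over its level \<open>k\<close>.
\<close>

lemma min_additive_partial_chain:
  assumes I: "is_interval I" "0 \<in> I" and f: "pos_horizontally_min_additive n I f"
    and \<sigma>: "\<sigma> permutes {1..n}" and x: "x \<in> region n (nonneg_part I) \<sigma>" and "k \<le> n"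
  shows "f x = (\<Sum>i=1..k. delta n f (upset n \<sigma> i) (level \<sigma> x i - level \<sigma> x (i - 1)))
           + f (cut_above n x (level \<sigma> x k))"
  using \<open>k \<le> n\<close>
proof (induction k)
  case 0
  have "cut_above n x (level \<sigma> x 0) = x"
    using region_cube[OF x] cube_nonneg_partD(2)[OF region_cube[OF x]]
    by (intro tuple_eqI[where n = n] tuple_extensional cube_extensional) (auto simp: tuple_defs level_def)
  then show ?case by simp
next
  case (Suc k)
  define y where "y = cut_above n x (level \<sigma> x k)"
  define c where "c = level \<sigma> x (Suc k) - level \<sigma> x k"
  have c: "c \<in> nonneg_part I"
    unfolding c_def using level_increment_mem[OF I x \<sigma>, of k "Suc k"] Suc.prems by simp
  have level_k: "0 \<le> level \<sigma> x k"
    using level_mono[OF x \<sigma>, of 0 k] Suc.prems by (simp add: level_def)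
  have "y \<in> cube n (nonneg_part I)"
  proof (rule cubeI)
    fix i assume i: "i \<in> {1..n}"
    show "y i \<in> nonneg_part I"
      using cube_component[OF region_cube[OF x] i] i level_k
      by (intro interval_below[OF I, of "x i"]) (auto simp: y_def tuple_defs nonneg_part_def)
  qed (simp add: y_def tuple_defs)
  then have "f y = f (tmin n y c) + f (cut_above n y c)"
    using f c unfolding pos_horizontally_min_additive_def by blast
  \<comment> \<open>All coordinates up to the \<open>k\<close>-th in sorted order have been used up; the others still have at least \<open>c\<close>.\<close>
  moreover have "tmin n y c = (\<lambda>i\<in>{1..n}. c * indicator (upset n \<sigma> (Suc k)) i)"
  proof (rule tuple_eqI[where n = n])
    fix i assume i: "i \<in> {1..n}"
    then obtain j where j: "j \<in> {1..n}" "i = \<sigma> j"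
      using permutes_image[OF \<sigma>] by (metis imageE)
    have mem: "i \<in> upset n \<sigma> (Suc k) \<longleftrightarrow> Suc k \<le> j"
      using j permutes_inj[OF \<sigma>] by (auto simp: upset_def inj_eq)
    have xi: "x i = level \<sigma> x j" using j by (simp add: level_def)
    show "tmin n y c i = (\<lambda>i\<in>{1..n}. c * indicator (upset n \<sigma> (Suc k)) i) i"
    proof (cases "Suc k \<le> j")
      case True
      then have "level \<sigma> x (Suc k) \<le> x i" using level_mono[OF x \<sigma>, of "Suc k" j] j xi by simp
      moreover have "0 \<le> c" using c by (simp add: nonneg_part_def)
      ultimately show ?thesis using i True mem by (simp add: y_def tuple_defs c_def)
    next
      case False
      then have "x i \<le> level \<sigma> x k" using level_mono[OF x \<sigma>, of j k] Suc.prems xi by simp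
      moreover have "0 \<le> c" using c by (simp add: nonneg_part_def)
      ultimately show ?thesis using i False mem by (simp add: y_def tuple_defs)
    qed
  qed (simp_all add: tuple_defs)
  moreover have "cut_above n y c = cut_above n x (level \<sigma> x (Suc k))"
    using c by (auto simp: y_def c_def tuple_defs nonneg_part_def fun_eq_iff)
  ultimately have "f (cut_above n x (level \<sigma> x k)) =
      delta n f (upset n \<sigma> (Suc k)) c + f (cut_above n x (level \<sigma> x (Suc k)))"
    by (simp add: y_def delta_def)
  with Suc show ?case by (simp add: c_def)
qed

lemma min_additive_imp_chain_represented:
  assumes I: "is_interval I" "0 \<in> I" and f: "pos_horizontally_min_additive n I f"
  shows "chain_represented n I f f"
  unfolding chain_represented_def
proof (intro conjI allI impI ballI)
  fix \<sigma> x assume \<sigma>: "\<sigma> permutes {1..n}" and x: "x \<in> region n (nonneg_part I) \<sigma>"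
  have "cut_above n x (level \<sigma> x n) = zero_tuple n"
  proof (rule tuple_eqI[where n = n])
    fix i assume i: "i \<in> {1..n}"
    then obtain j where j: "j \<in> {1..n}" "i = \<sigma> j"
      using permutes_image[OF \<sigma>] by (metis imageE)
    then have "x i \<le> level \<sigma> x n"
      using level_mono[OF x \<sigma>, of j n] by (simp add: level_def)
    then show "cut_above n x (level \<sigma> x n) i = zero_tuple n i"
      using i by (simp add: tuple_defs)
  qed (simp_all add: tuple_defs)
  then show "f x = chain_sum n f \<sigma> x"
    using min_additive_partial_chain[OF I f \<sigma> x, of n] min_additive_zero[OF f I(2)]
    by (simp add: chain_sum_def)
qed (rule min_additive_imp_delta_additive[OF f I(2)])

text \<open>
  Comonotonic tuples share a sorting permutation, hence also their sets of coordinates above each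
  level; the thicknesses of the slices just add up.
\<close>

lemma chain_represented_imp_comonotonically_additive:
  assumes I: "is_interval I" "0 \<in> I" and f: "chain_represented n I f g"
  shows "pos_comonotonically_additive n I f"
  unfolding pos_comonotonically_additive_def comonotonically_additive_on_def
proof (intro ballI impI)
  fix x x' assume xx: "x \<in> cube n (nonneg_part I)" "x' \<in> cube n (nonneg_part I)"
    and "comonotonic n I x x'" and sum: "tplus n x x' \<in> cube n (nonneg_part I)"
  then obtain \<sigma> where \<sigma>: "\<sigma> permutes {1..n}" and "x \<in> region n I \<sigma>" "x' \<in> region n I \<sigma>"
    unfolding comonotonic_def by blast
  then have x: "x \<in> region n (nonneg_part I) \<sigma>" and x': "x' \<in> region n (nonneg_part I) \<sigma>"
    using xx by (simp_all add: region_nonneg_part)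
  have \<sigma>_mem: "\<sigma> i \<in> {1..n}" if "i \<in> {1..n}" for i
    using permutes_in_image[OF \<sigma>] that by blast
  have "tplus n x x' (\<sigma> i) \<le> tplus n x x' (\<sigma> (Suc i))" if "i \<in> {1..<n}" for i
    using x x' that \<sigma>_mem[of i] \<sigma>_mem[of "Suc i"]
    by (auto simp: region_def tplus_def intro!: add_mono)
  then have s: "tplus n x x' \<in> region n (nonneg_part I) \<sigma>"
    using sum by (simp add: region_def)
  have level_sum: "level \<sigma> (tplus n x x') i = level \<sigma> x i + level \<sigma> x' i" if "i \<le> n" for i
    using that \<sigma>_mem[of i] by (auto simp: level_def tplus_def)
  have "delta n g (upset n \<sigma> i) (level \<sigma> (tplus n x x') i - level \<sigma> (tplus n x x') (i - 1)) =
      delta n g (upset n \<sigma> i) (level \<sigma> x i - level \<sigma> x (i - 1)) +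
      delta n g (upset n \<sigma> i) (level \<sigma> x' i - level \<sigma> x' (i - 1))" if i: "i \<in> {1..n}" for i
  proof -
    have "upset n \<sigma> i \<subseteq> {1..n}" using i \<sigma>_mem by (auto simp: upset_def)
    then have "additive_on (nonneg_part I) (delta n g (upset n \<sigma> i))"
      using f by (simp add: chain_represented_def)
    moreover have split: "level \<sigma> (tplus n x x') i - level \<sigma> (tplus n x x') (i - 1) =
        (level \<sigma> x i - level \<sigma> x (i - 1)) + (level \<sigma> x' i - level \<sigma> x' (i - 1))"
      using level_sum[of i] level_sum[of "i - 1"] \<open>i \<in> {1..n}\<close> by (simp add: le_diff_conv)
    moreover have "i - 1 \<le> i" "i \<le> n" using i by auto
    ultimately show ?thesis
      using level_increment_mem[OF I x \<sigma>, of "i - 1" i] level_increment_mem[OF I x' \<sigma>, of "i - 1" i]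
        level_increment_mem[OF I s \<sigma>, of "i - 1" i]
      unfolding additive_on_def by metis
  qed
  then have "chain_sum n g \<sigma> (tplus n x x') = chain_sum n g \<sigma> x + chain_sum n g \<sigma> x'"
    unfolding chain_sum_def sum.distrib[symmetric] by (intro sum.cong) simp_all
  then show "f (tplus n x x') = f x + f x'"
    using f \<sigma> x x' s by (simp add: chain_represented_def)
qed

text \<open>
  Both \<open>min t c\<close> and \<open>t - min t c\<close> increase with \<open>t\<close>, so the two parts of a cut are comonotonic.
\<close>

lemma comonotonically_additive_imp_min_additive:
  assumes I: "is_interval I" "0 \<in> I" and f: "pos_comonotonically_additive n I f"
  shows "pos_horizontally_min_additive n I f"
  unfolding pos_horizontally_min_additive_def
proof (intro ballI)
  fix x c assume x: "x \<in> cube n (nonneg_part I)" and c: "c \<in> nonneg_part I"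
  obtain \<sigma> where \<sigma>: "\<sigma> permutes {1..n}" and reg: "x \<in> region n (nonneg_part I) \<sigma>"
    using sorting_permutation_exists[OF x] .
  have comp: "min (x i) c \<in> nonneg_part I" "x i - min (x i) c \<in> nonneg_part I"
    if "i \<in> {1..n}" for i
    using cube_component[OF x that] c
    by (intro interval_below[OF I, of "x i"]; simp add: nonneg_part_def)+
  then have cubes: "tmin n x c \<in> cube n (nonneg_part I)" "cut_above n x c \<in> cube n (nonneg_part I)"
    by (auto intro!: cubeI tuple_extensional simp: tuple_defs)
  have "tmin n x c \<in> region n (nonneg_part I) \<sigma>"
    using reg \<sigma> by (rule region_image[where \<phi> = "\<lambda>t. min t c"])
      (use cubes in \<open>auto simp: mono_def tuple_defs\<close>)
  moreover have "cut_above n x c \<in> region n (nonneg_part I) \<sigma>"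
    using reg \<sigma> by (rule region_image[where \<phi> = "\<lambda>t. t - min t c"])
      (use cubes in \<open>auto simp: mono_def tuple_defs\<close>)
  ultimately have "comonotonic n I (tmin n x c) (cut_above n x c)"
    using \<sigma> by (auto simp: comonotonic_def region_nonneg_part)
  moreover have sum: "tplus n (tmin n x c) (cut_above n x c) = x"
    using cube_extensional[OF x]
    by (intro tuple_eqI[where n = n] tuple_extensional) (auto simp: tuple_defs)
  ultimately show "f x = f (tmin n x c) + f (cut_above n x c)"
    using f cubes x
    unfolding pos_comonotonically_additive_def comonotonically_additive_on_def by metis
qed

lemma pos_comonotonically_additive_iff_min_additive:
  assumes "is_interval I" "0 \<in> I"
  shows "pos_comonotonically_additive n I f \<longleftrightarrow> pos_horizontally_min_additive n I f"
  using comonotonically_additive_imp_min_additive[OF assms]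
    chain_represented_imp_comonotonically_additive[OF assms]
    min_additive_imp_chain_represented[OF assms] by blast

section \<open>Reflection at the origin\<close>

definition reflect :: "nat \<Rightarrow> ((nat \<Rightarrow> real) \<Rightarrow> real) \<Rightarrow> (nat \<Rightarrow> real) \<Rightarrow> real" where
  "reflect n f x = f (tneg n x)"

text \<open>
  Negation reverses the order of the components: if \<open>\<sigma>\<close> sorts \<open>x\<close> then \<open>\<sigma> \<circ> mirror n\<close> sorts \<open>- x\<close>. Outside
  \<open>{1..n}\<close> it must be the identity to be a permutation of \<open>{1..n}\<close>.
\<close>

definition mirror :: "nat \<Rightarrow> nat \<Rightarrow> nat" where
  "mirror n i = (if i \<in> {1..n} then n + 1 - i else i)"

lemma tneg_tneg: "x \<in> extensional {1..n} \<Longrightarrow> tneg n (tneg n x) = x"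
  by (rule tuple_eqI[where n = n]) (auto simp: tneg_def)

lemma nonneg_part_uminus:
  fixes I :: "real set"
  assumes "\<forall>x\<in>I. - x \<in> I"
  shows "- c \<in> nonneg_part I \<longleftrightarrow> c \<in> nonpos_part I" "- c \<in> nonpos_part I \<longleftrightarrow> c \<in> nonneg_part I"
proof -
  have "- c \<in> I \<longleftrightarrow> c \<in> I" using assms by (metis minus_minus)
  then show "- c \<in> nonneg_part I \<longleftrightarrow> c \<in> nonpos_part I" "- c \<in> nonpos_part I \<longleftrightarrow> c \<in> nonneg_part I"
    by (auto simp: nonneg_part_def nonpos_part_def)
qed

lemma ball_nonpos_part:
  assumes "\<forall>x\<in>I. - x \<in> I"
  shows "(\<forall>c\<in>nonpos_part I. P c) \<longleftrightarrow> (\<forall>c\<in>nonneg_part I. P (- c))"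
  using nonneg_part_uminus[OF assms] by (metis minus_minus)

lemma tneg_cube_nonpos_iff:
  assumes "\<forall>x\<in>I. - x \<in> I" "x \<in> extensional {1..n}"
  shows "tneg n x \<in> cube n (nonpos_part I) \<longleftrightarrow> x \<in> cube n (nonneg_part I)"
  using assms(2) nonneg_part_uminus[OF assms(1)]
  by (auto simp: cube_def tneg_def PiE_def Pi_def)

lemma tneg_cube_nonneg:
  assumes "\<forall>x\<in>I. - x \<in> I" "x \<in> cube n (nonpos_part I)"
  shows "tneg n x \<in> cube n (nonneg_part I)"
  using assms(2) nonneg_part_uminus[OF assms(1)]
  by (auto simp: cube_def tneg_def PiE_def Pi_def)

lemma ball_cube_nonpos:
  assumes "\<forall>x\<in>I. - x \<in> I"
  shows "(\<forall>x\<in>cube n (nonpos_part I). P x) \<longleftrightarrow> (\<forall>x\<in>cube n (nonneg_part I). P (tneg n x))"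
proof (intro iffI ballI)
  fix x assume "\<forall>x\<in>cube n (nonpos_part I). P x" "x \<in> cube n (nonneg_part I)"
  then show "P (tneg n x)" using tneg_cube_nonpos_iff[OF assms] cube_extensional by blast
next
  fix x assume "\<forall>x\<in>cube n (nonneg_part I). P (tneg n x)" "x \<in> cube n (nonpos_part I)"
  then show "P x" using tneg_cube_nonneg[OF assms] tneg_tneg cube_extensional by metis
qed

lemma mirror_mirror: "mirror n (mirror n i) = i"
  by (auto simp: mirror_def)

lemma mirror_permutes: "mirror n permutes {1..n}"
proof (rule bij_imp_permutes)
  show "bij_betw (mirror n) {1..n} {1..n}"
    by (rule bij_betw_byWitness[where f' = "mirror n"]) (auto simp: mirror_def)
qed (simp only: mirror_def if_False)

lemma comp_mirror_permutes: "\<sigma> permutes {1..n} \<Longrightarrow> \<sigma> \<circ> mirror n permutes {1..n}"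
  by (rule permutes_compose[OF mirror_permutes])

lemma comp_mirror_mirror: "(\<sigma> \<circ> mirror n) \<circ> mirror n = \<sigma>"
  by (auto simp: mirror_mirror)

lemma region_tneg:
  assumes "\<forall>x\<in>I. - x \<in> I" and \<sigma>: "\<sigma> permutes {1..n}" and x: "x \<in> region n I \<sigma>"
  shows "tneg n x \<in> region n I (\<sigma> \<circ> mirror n)"
proof -
  have "tneg n x \<in> cube n I"
    using assms(1) region_cube[OF x] by (auto simp: cube_def tneg_def PiE_def Pi_def)
  moreover have "tneg n x ((\<sigma> \<circ> mirror n) i) \<le> tneg n x ((\<sigma> \<circ> mirror n) (Suc i))"
    if i: "i \<in> {1..<n}" for i
  proof -
    have "mirror n i = n + 1 - i" "mirror n (Suc i) = n - i" using i by (auto simp: mirror_def)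
    moreover have "x (\<sigma> (n - i)) \<le> x (\<sigma> (n + 1 - i))"
      using region_mono[OF x, of "n - i" "n + 1 - i"] i by auto
    moreover have "\<sigma> (n - i) \<in> {1..n}" "\<sigma> (n + 1 - i) \<in> {1..n}"
      using i permutes_in_image[OF \<sigma>, of "n - i"] permutes_in_image[OF \<sigma>, of "n + 1 - i"] by auto
    ultimately show ?thesis by (simp add: tneg_def)
  qed
  ultimately show ?thesis by (simp add: region_def)
qed

lemma comonotonic_tneg:
  assumes "\<forall>x\<in>I. - x \<in> I" "x \<in> extensional {1..n}" "y \<in> extensional {1..n}"
  shows "comonotonic n I (tneg n x) (tneg n y) \<longleftrightarrow> comonotonic n I x y"
proof -
  have "comonotonic n I (tneg n x) (tneg n y)" if "comonotonic n I x y" for x y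
    using that region_tneg[OF assms(1)] comp_mirror_permutes unfolding comonotonic_def by blast
  from this[of x y] this[of "tneg n x" "tneg n y"] show ?thesis
    using assms(2,3) by (auto simp: tneg_tneg)
qed

lemma neg_max_additive_iff_reflect:
  assumes "\<forall>x\<in>I. - x \<in> I"
  shows "neg_horizontally_max_additive n I f \<longleftrightarrow> pos_horizontally_min_additive n I (reflect n f)"
proof -
  have "tmax n (tneg n x) (- c) = tneg n (tmin n x c)"
    "cut_below n (tneg n x) (- c) = tneg n (cut_above n x c)" for x c
    by (auto simp: tuple_defs fun_eq_iff)
  then show ?thesis
    unfolding neg_horizontally_max_additive_def pos_horizontally_min_additive_def
      ball_cube_nonpos[OF assms] ball_nonpos_part[OF assms]
    by (simp add: reflect_def)
qed

lemma neg_comonotonically_additive_iff_reflect: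
  assumes "\<forall>x\<in>I. - x \<in> I"
  shows "neg_comonotonically_additive n I f \<longleftrightarrow> pos_comonotonically_additive n I (reflect n f)"
proof -
  have "tplus n (tneg n x) (tneg n y) = tneg n (tplus n x y)" for x y
    by (auto simp: tuple_defs fun_eq_iff)
  then show ?thesis
    unfolding neg_comonotonically_additive_def pos_comonotonically_additive_def
      comonotonically_additive_on_def ball_cube_nonpos[OF assms]
    by (intro ball_cong refl)
      (simp add: reflect_def comonotonic_tneg[OF assms cube_extensional cube_extensional]
        tneg_cube_nonpos_iff[OF assms tuple_extensional(8)])
qed

lemma delta_reflect: "delta n (reflect n h) A t = delta n h A (- t)"
  unfolding delta_def reflect_def by (rule arg_cong[where f = h]) (auto simp: tneg_def)

lemma additive_on_nonpos_iff_reflect: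
  assumes "\<forall>x\<in>I. - x \<in> I"
  shows "additive_on (nonpos_part I) (delta n h A) \<longleftrightarrow>
    additive_on (nonneg_part I) (delta n (reflect n h) A)"
proof -
  have "- s + - t = - (s + t)" for s t :: real by simp
  then show ?thesis
    unfolding additive_on_def ball_nonpos_part[OF assms] delta_reflect
    by (simp only: nonneg_part_uminus[OF assms])
qed

section \<open>Positive and negative parts\<close>

lemma tpos_cube:
  assumes "0 \<in> I" "x \<in> cube n I"
  shows "tpos n x \<in> cube n (nonneg_part I)"
  using assms cube_component[OF assms(2)]
  by (intro cubeI tuple_extensional) (auto simp: tuple_defs nonneg_part_def max_def)

lemma tneg_cube:
  assumes "\<forall>x\<in>I. - x \<in> I" "x \<in> cube n I"
  shows "tneg n x \<in> cube n I"
  using assms cube_component[OF assms(2)]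
  by (intro cubeI tuple_extensional) (auto simp: tuple_defs)

lemma tpos_region:
  assumes "0 \<in> I" "\<sigma> permutes {1..n}" "x \<in> region n I \<sigma>"
  shows "tpos n x \<in> region n (nonneg_part I) \<sigma>"
  using assms(3,2) by (rule region_image[where \<phi> = "\<lambda>t. max t 0"])
    (use tpos_cube[OF assms(1) region_cube[OF assms(3)]] in \<open>auto simp: mono_def tuple_defs\<close>)

lemma tnegpart_region:
  assumes "0 \<in> I" "\<forall>x\<in>I. - x \<in> I" "\<sigma> permutes {1..n}" "x \<in> region n I \<sigma>"
  shows "tnegpart n x \<in> region n (nonneg_part I) (\<sigma> \<circ> mirror n)"
  unfolding tnegpart_def
  by (rule tpos_region[OF assms(1) comp_mirror_permutes[OF assms(3)] region_tneg[OF assms(2-4)]])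

text \<open>
  The levels of the positive part are 0 up to the index \<open>p\<close> and those of \<open>x\<close> afterwards. So the
  slices up to \<open>p\<close> are empty, and the slice \<open>p + 1\<close> starts at 0, not at \<open>x (\<sigma> p)\<close>.
\<close>

lemma chain_sum_tpos:
  assumes \<sigma>: "\<sigma> permutes {1..n}" and x: "x \<in> region n I \<sigma>" and g: "g (zero_tuple n) = 0"
    and p: "p = neg_count n x"
  shows "chain_sum n g \<sigma> (tpos n x) =
      (if p = n then 0 else delta n g (upset n \<sigma> (p + 1)) (x (\<sigma> (p + 1))))
    + (\<Sum>i = p + 2..n. delta n g (upset n \<sigma> i) (x (\<sigma> i) - x (\<sigma> (i - 1))))"
proof -
  let ?t = "\<lambda>i. delta n g (upset n \<sigma> i) (level \<sigma> (tpos n x) i - level \<sigma> (tpos n x) (i - 1))"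
  have pn: "p \<le> n" and lo: "1 \<le> p \<Longrightarrow> x (\<sigma> p) < 0" and hi: "p < n \<Longrightarrow> 0 \<le> x (\<sigma> (p + 1))"
    using p neg_count_iff[OF \<sigma> x, of p] by auto
  have \<sigma>_mem: "\<sigma> i \<in> {1..n}" if "i \<in> {1..n}" for i
    using permutes_in_image[OF \<sigma>] that by blast
  have low: "level \<sigma> (tpos n x) i = 0" if "i \<le> p" for i
    using that pn region_mono[OF x, of i p] lo \<sigma>_mem[of i] by (auto simp: level_def tuple_defs)
  have high: "level \<sigma> (tpos n x) i = x (\<sigma> i)" if "p < i" "i \<le> n" for i
    using that region_mono[OF x, of "p + 1" i] hi \<sigma>_mem[of i] by (auto simp: level_def tuple_defs)
  have "chain_sum n g \<sigma> (tpos n x) = (\<Sum>i=1..p. ?t i) + (\<Sum>i=p+1..n. ?t i)"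
    unfolding chain_sum_def using pn sum.ub_add_nat[of 1 p ?t "n - p"] by simp
  also have "(\<Sum>i=1..p. ?t i) = 0"
    using low g by (intro sum.neutral) (auto simp: delta_zero)
  also have "(\<Sum>i=p+1..n. ?t i) =
      (if p = n then 0 else delta n g (upset n \<sigma> (p + 1)) (x (\<sigma> (p + 1)))) + (\<Sum>i=p+2..n. ?t i)"
    using pn low[of p] high[of "p + 1"] by (auto simp: sum.atLeast_Suc_atMost)
  also have "(\<Sum>i=p+2..n. ?t i) =
      (\<Sum>i=p+2..n. delta n g (upset n \<sigma> i) (x (\<sigma> i) - x (\<sigma> (i - 1))))"
    using high by (intro sum.cong) auto
  finally show ?thesis by simp
qed

text \<open>
  The coordinates that are large after reflection are those that were small before.
\<close>

lemma upset_mirror: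
  assumes "i \<in> {1..n}"
  shows "upset n (\<sigma> \<circ> mirror n) (n + 1 - i) = downset \<sigma> i"
proof -
  have "mirror n ` {n + 1 - i..n} = {1..i}"
  proof (intro equalityI subsetI)
    fix j assume "j \<in> {1..i}"
    then show "j \<in> mirror n ` {n + 1 - i..n}"
      using assms by (intro image_eqI[of _ _ "n + 1 - j"]) (auto simp: mirror_def)
  qed (use assms in \<open>auto simp: mirror_def\<close>)
  then show ?thesis by (metis upset_def downset_def image_comp)
qed

text \<open>
  The negative counterpart: after reflection the slice that starts at 0 belongs to the index \<open>p\<close>,
  and the slices of the indices above \<open>p\<close> are empty.
\<close>

lemma chain_sum_tnegpart:
  assumes \<sigma>: "\<sigma> permutes {1..n}" and x: "x \<in> region n I \<sigma>" and h: "h (zero_tuple n) = 0"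
    and p: "p = neg_count n x"
  shows "chain_sum n (reflect n h) (\<sigma> \<circ> mirror n) (tnegpart n x) =
      (if p = 0 then 0 else delta n h (downset \<sigma> p) (x (\<sigma> p)))
    + (\<Sum>i = 1..p - 1. delta n h (downset \<sigma> i) (x (\<sigma> i) - x (\<sigma> (i + 1))))"
proof -
  let ?y = "level (\<sigma> \<circ> mirror n) (tnegpart n x)"
  let ?t = "\<lambda>i. delta n h (downset \<sigma> i) (?y (n - i) - ?y (n + 1 - i))"
  have pn: "p \<le> n" and lo: "1 \<le> p \<Longrightarrow> x (\<sigma> p) < 0" and hi: "p < n \<Longrightarrow> 0 \<le> x (\<sigma> (p + 1))"
    using p neg_count_iff[OF \<sigma> x, of p] by auto
  have \<sigma>_mem: "\<sigma> i \<in> {1..n}" if "i \<in> {1..n}" for i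
    using permutes_in_image[OF \<sigma>] that by blast
  have low: "?y (n + 1 - i) = - x (\<sigma> i)" if "1 \<le> i" "i \<le> p" for i
    using that pn region_mono[OF x, of i p] lo \<sigma>_mem[of i]
    by (auto simp: level_def tuple_defs mirror_def)
  have high: "?y (n + 1 - i) = 0" if "p < i" "i \<le> n + 1" for i
    using that region_mono[OF x, of "p + 1" i] hi \<sigma>_mem[of i]
    by (auto simp: level_def tuple_defs mirror_def)
  have "chain_sum n (reflect n h) (\<sigma> \<circ> mirror n) (tnegpart n x) =
      (\<Sum>i=1..n. delta n h (upset n (\<sigma> \<circ> mirror n) i) (?y (i - 1) - ?y i))"
    by (simp add: chain_sum_def delta_reflect)
  also have "\<dots> = (\<Sum>i=1..n. ?t i)"
  proof (rule sum.reindex_bij_witness[where i = "\<lambda>i. n + 1 - i" and j = "\<lambda>i. n + 1 - i"])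
    fix i assume i: "i \<in> {1..n}"
    then have mem: "n + 1 - i \<in> {1..n}" and idx: "n - (n + 1 - i) = i - 1" "n + 1 - (n + 1 - i) = i"
      by auto
    have "downset \<sigma> (n + 1 - i) = upset n (\<sigma> \<circ> mirror n) i"
      using upset_mirror[OF mem, of \<sigma>] by (simp only: idx)
    with idx show "?t (n + 1 - i) = delta n h (upset n (\<sigma> \<circ> mirror n) i) (?y (i - 1) - ?y i)"
      by simp
  qed auto
  also have "\<dots> = (\<Sum>i=1..p. ?t i) + (\<Sum>i=p+1..n. ?t i)"
    using pn sum.ub_add_nat[of 1 p ?t "n - p"] by simp
  also have "(\<Sum>i=p+1..n. ?t i) = 0"
  proof (intro sum.neutral ballI)
    fix i assume "i \<in> {p+1..n}"
    then show "?t i = 0" using high[of i] high[of "i + 1"] h by (simp add: delta_zero)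
  qed
  also have "(\<Sum>i=1..p. ?t i) = (if p = 0 then 0 else delta n h (downset \<sigma> p) (x (\<sigma> p)))
      + (\<Sum>i = 1..p - 1. ?t i)"
    using pn low[of p] high[of "p + 1"] by (cases p) auto
  also have "(\<Sum>i = 1..p - 1. ?t i) =
      (\<Sum>i = 1..p - 1. delta n h (downset \<sigma> i) (x (\<sigma> i) - x (\<sigma> (i + 1))))"
  proof (intro sum.cong refl)
    fix i assume "i \<in> {1..p - 1}"
    then have "1 \<le> i" "i \<le> p" "i + 1 \<le> p" by auto
    then show "?t i = delta n h (downset \<sigma> i) (x (\<sigma> i) - x (\<sigma> (i + 1)))"
      using low[of i] low[of "i + 1"] by (simp add: add.commute)
  qed
  finally show ?thesis by (simp only: comp_def add_0_right)
qed

lemma sorted_formula_eq_chain_sums: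
  assumes "\<sigma> permutes {1..n}" "x \<in> region n I \<sigma>" "g (zero_tuple n) = 0" "h (zero_tuple n) = 0"
  shows "sorted_formula n g h \<sigma> x =
    chain_sum n g \<sigma> (tpos n x) + chain_sum n (reflect n h) (\<sigma> \<circ> mirror n) (tnegpart n x)"
  using chain_sum_tpos[where g = g, OF assms(1-3) refl]
    chain_sum_tnegpart[where h = h, OF assms(1,2,4) refl]
  by (simp add: sorted_formula_def Let_def)

lemma chain_sum_zero:
  assumes "\<sigma> permutes {1..n}" "g (zero_tuple n) = 0"
  shows "chain_sum n g \<sigma> (zero_tuple n) = 0"
proof -
  have "level \<sigma> (zero_tuple n) i = 0" if "i \<le> n" for i
    using that permutes_in_image[OF assms(1), of i] by (auto simp: level_def zero_tuple_def)
  then show ?thesis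
    using assms(2) by (auto intro!: sum.neutral simp: chain_sum_def delta_zero)
qed

lemma reflect_zero_tuple: "reflect n h (zero_tuple n) = h (zero_tuple n)"
  unfolding reflect_def by (rule arg_cong[where f = h]) (auto simp: tuple_defs)

lemma nonneg_parts:
  assumes "x \<in> cube n (nonneg_part I)"
  shows "tpos n x = x" "tnegpart n x = zero_tuple n"
    "tpos n (tneg n x) = zero_tuple n" "tnegpart n (tneg n x) = x"
  using cube_nonneg_partD(2)[OF assms] cube_extensional[OF assms]
  by (auto intro!: tuple_eqI[where n = n] tuple_extensional simp: tuple_defs)

text \<open>
  A tuple of constant sign has a zero positive or negative part, so evaluating the formula on the
  two cones isolates the two slice formulas; their sum is then the sign splitting.
\<close>

lemma represented_by_iff:
  assumes I: "0 \<in> I" "\<forall>x\<in>I. - x \<in> I"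
  shows "represented_by n I f g h \<longleftrightarrow>
    chain_represented n I f g \<and> chain_represented n I (reflect n f) (reflect n h) \<and> sign_split n I f"
    (is "_ \<longleftrightarrow> ?R")
proof
  assume rep: "represented_by n I f g h"
  have add: "additive_on (nonneg_part I) (delta n g A)"
      "additive_on (nonneg_part I) (delta n (reflect n h) A)" if "A \<subseteq> {1..n}" for A
    using rep that by (auto simp: represented_by_def additive_on_nonpos_iff_reflect[OF I(2)])
  then have g0: "g (zero_tuple n) = 0" and h0: "h (zero_tuple n) = 0"
    using additive_delta_zero[OF add(1)[of "{}"] I(1)] additive_delta_zero[OF add(2)[of "{}"] I(1)]
    by (simp_all add: reflect_zero_tuple)
  have formula: "f x = chain_sum n g \<sigma> (tpos n x)
      + chain_sum n (reflect n h) (\<sigma> \<circ> mirror n) (tnegpart n x)"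
    if "\<sigma> permutes {1..n}" "x \<in> region n I \<sigma>" for \<sigma> x
    using rep that sorted_formula_eq_chain_sums[where g = g and h = h, OF that g0 h0] by (simp add: represented_by_def)
  have pos: "f x = chain_sum n g \<sigma> x"
    if \<sigma>: "\<sigma> permutes {1..n}" and x: "x \<in> region n (nonneg_part I) \<sigma>" for \<sigma> x
  proof -
    have "x \<in> region n I \<sigma>" "x \<in> cube n (nonneg_part I)"
      using x by (simp_all add: region_nonneg_part)
    then show ?thesis
      using formula[OF \<sigma>] chain_sum_zero[OF comp_mirror_permutes[OF \<sigma>]] h0
      by (simp add: nonneg_parts reflect_zero_tuple)
  qed
  have neg: "reflect n f x = chain_sum n (reflect n h) \<sigma> x"
    if \<sigma>: "\<sigma> permutes {1..n}" and x: "x \<in> region n (nonneg_part I) \<sigma>" for \<sigma> x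
  proof -
    have "x \<in> region n I \<sigma>" and xc: "x \<in> cube n (nonneg_part I)"
      using x by (simp_all add: region_nonneg_part)
    then have "tneg n x \<in> region n I (\<sigma> \<circ> mirror n)"
      using region_tneg[OF I(2) \<sigma>] by blast
    from formula[OF comp_mirror_permutes[OF \<sigma>] this] show ?thesis
      using chain_sum_zero[OF comp_mirror_permutes[OF \<sigma>], of g] g0 xc
      by (simp add: nonneg_parts comp_mirror_mirror reflect_def[of n f])
  qed
  have "sign_split n I f"
    unfolding sign_split_def
  proof
    fix x assume "x \<in> cube n I"
    then obtain \<sigma> where \<sigma>: "\<sigma> permutes {1..n}" and x: "x \<in> region n I \<sigma>"
      by (rule sorting_permutation_exists)
    show "f x = f (tpos n x) + f (tneg n (tnegpart n x))"
      using formula[OF \<sigma> x] pos[OF \<sigma> tpos_region[OF I(1) \<sigma> x]]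
        neg[OF comp_mirror_permutes[OF \<sigma>] tnegpart_region[OF I \<sigma> x]]
      by (simp add: reflect_def[of n f])
  qed
  then show ?R
    using add pos neg by (simp add: chain_represented_def)
next
  assume R: ?R
  then have add: "additive_on (nonneg_part I) (delta n g A)"
      "additive_on (nonneg_part I) (delta n (reflect n h) A)" if "A \<subseteq> {1..n}" for A
    using that by (auto simp: chain_represented_def)
  then have g0: "g (zero_tuple n) = 0" and h0: "h (zero_tuple n) = 0"
    using additive_delta_zero[OF add(1)[of "{}"] I(1)] additive_delta_zero[OF add(2)[of "{}"] I(1)]
    by (simp_all add: reflect_zero_tuple)
  have "f x = sorted_formula n g h \<sigma> x"
    if \<sigma>: "\<sigma> permutes {1..n}" and x: "x \<in> region n I \<sigma>" for \<sigma> x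
  proof -
    have "f x = f (tpos n x) + reflect n f (tnegpart n x)"
      using R region_cube[OF x] by (simp add: sign_split_def reflect_def)
    moreover have "f (tpos n x) = chain_sum n g \<sigma> (tpos n x)"
      using R \<sigma> tpos_region[OF I(1) \<sigma> x] by (simp add: chain_represented_def)
    moreover have "reflect n f (tnegpart n x) =
        chain_sum n (reflect n h) (\<sigma> \<circ> mirror n) (tnegpart n x)"
      using R comp_mirror_permutes[OF \<sigma>] tnegpart_region[OF I \<sigma> x]
      by (simp add: chain_represented_def)
    ultimately show ?thesis
      by (simp add: sorted_formula_eq_chain_sums[where g = g and h = h, OF \<sigma> x g0 h0])
  qed
  then show "represented_by n I f g h"
    using add by (simp add: represented_by_def additive_on_nonpos_iff_reflect[OF I(2)])
qed

section \<open>Median-additivity\<close>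

lemma tmed_component:
  "0 \<le> c \<Longrightarrow> tmed n (- c) x c = (\<lambda>i\<in>{1..n}. max (- c) (min (x i) c))"
  by (simp add: tmed_def middle_symmetric)

text \<open>
  Every instance of the median identity is the sum of a min-cut and a max-cut. On tuples of constant
  sign, or at \<open>c = 0\<close>, a term on the zero tuple appears; the instance at the zero tuple gives
  \<open>f 0 = 3 f 0\<close> and disposes of it.
\<close>

lemma median_additive_iff:
  assumes I: "is_interval I" "0 \<in> I" "\<forall>x\<in>I. - x \<in> I"
  shows "horizontally_median_additive n I f \<longleftrightarrow>
    pos_horizontally_min_additive n I f \<and> neg_horizontally_max_additive n I f \<and> sign_split n I f"
    (is "_ \<longleftrightarrow> ?R")
proof
  assume f: "horizontally_median_additive n I f"
  then have med: "f x = f (tmed n (- c) x c) + f (cut_above n x c) + f (cut_below n x (- c))"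
    if "x \<in> cube n I" "c \<in> nonneg_part I" for x c
    using that by (simp add: horizontally_median_additive_def)
  have zero_mem: "0 \<in> nonneg_part I" using I(2) by (simp add: nonneg_part_def)
  have "f (zero_tuple n) = f (zero_tuple n) + f (zero_tuple n) + f (zero_tuple n)"
  proof -
    have "tmed n (- 0) (zero_tuple n) 0 = zero_tuple n" "cut_above n (zero_tuple n) 0 = zero_tuple n"
      "cut_below n (zero_tuple n) (- 0) = zero_tuple n"
      by (auto simp: tuple_defs tmed_component[of 0, simplified])
    with med[OF zero_tuple_cube[OF I(2)] zero_mem] show ?thesis by simp
  qed
  then have f0: "f (zero_tuple n) = 0" by simp
  have "sign_split n I f"
    unfolding sign_split_def
  proof
    fix x assume "x \<in> cube n I"
    moreover have "tmed n (- 0) x 0 = zero_tuple n" "cut_above n x 0 = tpos n x"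
      "cut_below n x (- 0) = tneg n (tnegpart n x)"
      by (auto simp: tuple_defs tmed_component[of 0, simplified] fun_eq_iff)
    ultimately show "f x = f (tpos n x) + f (tneg n (tnegpart n x))"
      using med[OF _ zero_mem, of x] f0 by simp
  qed
  moreover have "pos_horizontally_min_additive n I f"
    unfolding pos_horizontally_min_additive_def
  proof (intro ballI)
    fix x c assume x: "x \<in> cube n (nonneg_part I)" and c: "c \<in> nonneg_part I"
    have "0 \<le> c" using c by (simp add: nonneg_part_def)
    then have "tmed n (- c) x c = tmin n x c" "cut_below n x (- c) = zero_tuple n"
      using cube_nonneg_partD(2)[OF x] by (fastforce simp: tuple_defs tmed_component fun_eq_iff)+
    then show "f x = f (tmin n x c) + f (cut_above n x c)"
      using med[OF cube_nonneg_partD(1)[OF x] c] f0 by simp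
  qed
  moreover have "neg_horizontally_max_additive n I f"
    unfolding neg_horizontally_max_additive_def
  proof (intro ballI)
    fix x c assume x: "x \<in> cube n (nonpos_part I)" and c: "c \<in> nonpos_part I"
    have c': "- c \<in> nonneg_part I" "c \<le> 0"
      using c nonneg_part_uminus[OF I(3)] by (auto simp: nonpos_part_def)
    then have "tmed n (- (- c)) x (- c) = tmax n x c" "cut_above n x (- c) = zero_tuple n"
      using cube_nonpos_partD(2)[OF x]
      by (fastforce simp: tuple_defs tmed_component[of "- c", simplified] fun_eq_iff)+
    then show "f x = f (tmax n x c) + f (cut_below n x c)"
      using med[OF cube_nonpos_partD(1)[OF x] c'(1)] f0 by simp
  qed
  ultimately show ?R by blast
next
  assume R: ?R
  show "horizontally_median_additive n I f"
    unfolding horizontally_median_additive_def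
  proof (intro ballI)
    fix x c assume x: "x \<in> cube n I" and c: "c \<in> nonneg_part I"
    have c0: "0 \<le> c" and cI: "c \<in> I" using c by (auto simp: nonneg_part_def)
    define m where "m = tmed n (- c) x c"
    have m: "m = (\<lambda>i\<in>{1..n}. max (- c) (min (x i) c))"
      unfolding m_def by (rule tmed_component[OF c0])
    have mc: "m \<in> cube n I"
    proof (rule cubeI)
      fix i assume i: "i \<in> {1..n}"
      show "m i \<in> I"
        using i cube_component[OF x i] I(3) cI by (auto simp: m max_def min_def)
    qed (simp add: m)
    have pos: "f (tpos n x) = f (tmin n (tpos n x) c) + f (cut_above n (tpos n x) c)"
      using R tpos_cube[OF I(2) x] c by (simp add: pos_horizontally_min_additive_def)
    have "tneg n (tnegpart n x) \<in> cube n (nonpos_part I)"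
      unfolding tnegpart_def
      using tpos_cube[OF I(2) tneg_cube[OF I(3) x]] tneg_cube_nonpos_iff[OF I(3)] cube_extensional
      by blast
    then have neg: "f (tneg n (tnegpart n x)) =
        f (tmax n (tneg n (tnegpart n x)) (- c)) + f (cut_below n (tneg n (tnegpart n x)) (- c))"
      using R c nonneg_part_uminus[OF I(3)] by (simp add: neg_horizontally_max_additive_def)
    \<comment> \<open>The lower part of each one-sided cut is the corresponding signed part of the median tuple.\<close>
    have parts: "tmin n (tpos n x) c = tpos n m" "cut_above n (tpos n x) c = cut_above n x c"
      "tmax n (tneg n (tnegpart n x)) (- c) = tneg n (tnegpart n m)"
      "cut_below n (tneg n (tnegpart n x)) (- c) = cut_below n x (- c)"
      using c0 by (auto simp: tuple_defs m fun_eq_iff)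
    have "f x = f (tpos n x) + f (tneg n (tnegpart n x))"
      "f m = f (tpos n m) + f (tneg n (tnegpart n m))"
      using R x mc by (simp_all add: sign_split_def)
    then show "f x = f (tmed n (- c) x c) + f (cut_above n x c) + f (cut_below n x (- c))"
      using pos neg parts by (simp add: m_def)
  qed
qed

lemma represented_by_imp_additive:
  assumes I: "is_interval I" "0 \<in> I" "\<forall>x\<in>I. - x \<in> I" and rep: "represented_by n I f g h"
  shows "horizontally_median_additive n I f"
proof -
  have "pos_comonotonically_additive n I f" "pos_comonotonically_additive n I (reflect n f)"
    "sign_split n I f"
    using rep represented_by_iff[OF I(2,3)] chain_represented_imp_comonotonically_additive[OF I(1,2)]
    by blast+
  then show ?thesis
    by (simp add: median_additive_iff[OF I] neg_max_additive_iff_reflect[OF I(3)]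
        pos_comonotonically_additive_iff_min_additive[OF I(1,2)])
qed

lemma median_additive_imp_represented_by_self:
  assumes I: "is_interval I" "0 \<in> I" "\<forall>x\<in>I. - x \<in> I" and f: "horizontally_median_additive n I f"
  shows "represented_by n I f f f"
  using f min_additive_imp_chain_represented[OF I(1,2)]
  by (simp add: represented_by_iff[OF I(2,3)] median_additive_iff[OF I]
      neg_max_additive_iff_reflect[OF I(3)])

theorem theorem10:
  fixes n :: nat and I :: "real set" and f :: "(nat \<Rightarrow> real) \<Rightarrow> real"
  assumes "n \<ge> 1"
    and "is_interval I" and "emeasure lborel I > 0" and "0 \<in> I"
    and "\<forall>x\<in>I. - x \<in> I"
  shows
    "(horizontally_median_additive n I f \<longleftrightarrow>
        pos_horizontally_min_additive n I f \<and> neg_horizontally_max_additive n I f \<and>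
        sign_split n I f) \<and>
     (horizontally_median_additive n I f \<longleftrightarrow>
        pos_horizontally_min_additive n I f \<and> neg_comonotonically_additive n I f \<and>
        sign_split n I f) \<and>
     (horizontally_median_additive n I f \<longleftrightarrow>
        pos_comonotonically_additive n I f \<and> neg_horizontally_max_additive n I f \<and>
        sign_split n I f) \<and>
     (horizontally_median_additive n I f \<longleftrightarrow>
        pos_comonotonically_additive n I f \<and> neg_comonotonically_additive n I f \<and>
        sign_split n I f) \<and>
     (horizontally_median_additive n I f \<longleftrightarrow> (\<exists>g h. represented_by n I f g h)) \<and>
     ((\<exists>g h. represented_by n I f g h) \<longrightarrow> represented_by n I f f f)"
proof -
  note I = assms(2,4,5)
  have pos: "pos_comonotonically_additive n I f \<longleftrightarrow> pos_horizontally_min_additive n I f"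
    by (rule pos_comonotonically_additive_iff_min_additive[OF I(1,2)])
  have neg: "neg_comonotonically_additive n I f \<longleftrightarrow> neg_horizontally_max_additive n I f"
    by (simp add: neg_comonotonically_additive_iff_reflect[OF I(3)]
        neg_max_additive_iff_reflect[OF I(3)]
        pos_comonotonically_additive_iff_min_additive[OF I(1,2)])
  show ?thesis
    unfolding pos neg
    using median_additive_iff[OF I] represented_by_imp_additive[OF I]
      median_additive_imp_represented_by_self[OF I]
    by blast
qed

end
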